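(* Let $(\mathcal X,d,\mu)$ be an upper doubling space whose dominating function $\lambda$ satisfies $\lambda(x,r)\le C_{(\lambda)}\lambda(y,r)$ for all $x,y\in\mathcal X$ and $r\in(0,\infty)$ with $d(x,y)\le r$. Let $B\subset\mathcal X$ be a ball. Then, for any $x_1,x_2\in B$ and $y\in\mathcal X\setminus(kB)$ with $k\in[2,\infty)$, $$\lambda(x_1,d(x_1,y))\sim\lambda(x_2,d(x_2,y)),$$ that is, there exists a positive constant $C$, independent of $B$, $k$, $x_1$, $x_2$ and $y$, such that $C^{-1}\lambda(x_2,d(x_2,y))\le\lambda(x_1,d(x_1,y))\le C\lambda(x_2,d(x_2,y))$.
   Context: A metric measure space $(\mathcal X,d,\mu)$ is upper doubling if $\mu$ is a Borel measure on $\mathcal X$ and there exist a dominating function $\lambda:\mathcal X\times(0,\infty)\to(0,\infty)$ and a positive constant $C_{(\lambda)}$, depending on $\lambda$, such that, for each $x\in\mathcal X$, $r\mapsto\lambda(x,r)$ is non-decreasing and, for all $x\in\mathcal X$ and $r\in(0,\infty)$, $\mu(B(x,r))\le\lambda(x,r)\le C_{(\lambda)}\lambda(x,r/2)$, where $B(x,r):=\{y\in\mathcal X:d(x,y)<r\}$. A ball $B=B(c_B,r_B)$ comes with its center $c_B$ and radius $r_B\in(0,\infty)$, and $kB:=B(c_B,kr_B)$. *)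

theory Defs
  imports "HOL-Analysis.Analysis"
begin

text \<open>
  The values of a dominating function \<open>lam\<close> matter only at positive radii; what it does at
  \<open>r \<le> 0\<close> is left unconstrained. The measure is not assumed to be finite a priori, so it is
  compared with \<open>lam\<close> in the extended nonnegative reals.
\<close>

definition dominating_function ::
    "'a::metric_space measure \<Rightarrow> ('a \<Rightarrow> real \<Rightarrow> real) \<Rightarrow> real \<Rightarrow> bool" where
  "dominating_function M lam C \<longleftrightarrow>
     0 < C \<and>
     (\<forall>x r. 0 < r \<longrightarrow> 0 < lam x r) \<and>
     (\<forall>x. mono_on {0<..} (lam x)) \<and>
     (\<forall>x r. 0 < r \<longrightarrow>
        emeasure M (ball x r) \<le> ennreal (lam x r) \<and> lam x r \<le> C * lam x (r / 2))"

definition upper_doubling_with ::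
    "'a::metric_space measure \<Rightarrow> ('a \<Rightarrow> real \<Rightarrow> real) \<Rightarrow> real \<Rightarrow> bool" where
  "upper_doubling_with M lam C \<longleftrightarrow> sets M = sets borel \<and> dominating_function M lam C"

end

theory Submission imports Defs begin

text \<open>
  Since \<open>y\<close> lies outside the doubled ball, each point of \<open>ball c r\<close> has distance more than \<open>r\<close>
  from \<open>y\<close>, while two such points are less than \<open>2 * r\<close> apart. Hence moving between \<open>x1\<close> and
  \<open>x2\<close> is a displacement comparable to the distance from either of them to \<open>y\<close>, and at such a
  scale \<open>lam\<close> changes by a bounded factor: the comparison of centres costs one constant, and the
  adjustment of the radius costs one more for each doubling
  (\<open>lam_dist_le_of_close_centres\<close>). The bound is symmetric in \<open>x1\<close> and \<open>x2\<close>, so it gives both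
  inequalities.
\<close>

lemma outside_doubled_ball_imp_dist_gt:
  fixes c x y :: "'a::metric_space"
  assumes "0 < r" "2 \<le> k" "x \<in> ball c r" "y \<notin> ball c (k * r)"
  shows "r < dist x y"
proof -
  have "2 * r \<le> k * r" using assms(1,2) by simp
  then show ?thesis using assms(3,4) dist_triangle[of c y x] by simp
qed

text \<open>
  The triangle inequality only gives \<open>dist x1 y \<le> 3 * dist x2 y\<close>; rounding \<open>3\<close> up to \<open>4\<close> makes
  the radius reachable by two doublings. At radius \<open>4 * dist x2 y\<close>, which exceeds
  \<open>dist x1 x2\<close>, the centre may be changed. One change of centre and two doublings account for
  the exponent \<open>3\<close>.
\<close>

lemma lam_dist_le_of_close_centres:
  fixes lam :: "'a::metric_space \<Rightarrow> real \<Rightarrow> real"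
  assumes dom: "dominating_function M lam C"
    and centre: "\<And>x y r. 0 < r \<Longrightarrow> dist x y \<le> r \<Longrightarrow> lam x r \<le> C * lam y r"
    and pos: "0 < dist x1 y"
    and close: "dist x1 x2 \<le> 2 * dist x2 y"
  shows "lam x1 (dist x1 y) \<le> C ^ 3 * lam x2 (dist x2 y)"
proof -
  let ?s = "dist x2 y"
  have C: "0 < C" and mono: "mono_on {0<..} (lam x1)"
    using dom by (auto simp: dominating_function_def)
  have doubling: "lam x2 r \<le> C * lam x2 (r / 2)" if "0 < r" for r
    using dom that by (auto simp: dominating_function_def)
  have tri: "dist x1 y \<le> 4 * ?s" and s: "0 < ?s"
    using pos close dist_triangle[of x1 y x2] zero_le_dist[of x2 y] by linarith+
  have "lam x1 (dist x1 y) \<le> lam x1 (4 * ?s)"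
    using mono_onD[OF mono] pos tri s by simp
  also have "\<dots> \<le> C * lam x2 (4 * ?s)"
    using centre[of "4 * ?s" x1 x2] s close by simp
  also have "\<dots> \<le> C * (C * lam x2 (2 * ?s))"
    using doubling[of "4 * ?s"] s C by (intro mult_left_mono) auto
  also have "\<dots> \<le> C * (C * (C * lam x2 ?s))"
    using doubling[of "2 * ?s"] s C by (intro mult_left_mono) auto
  also have "\<dots> = C ^ 3 * lam x2 ?s"
    by (simp add: power3_eq_cube)
  finally show ?thesis .
qed

theorem lemma2p3:
  fixes M :: "'a::metric_space measure"
    and lam :: "'a \<Rightarrow> real \<Rightarrow> real"
    and C_lam :: real
  assumes "upper_doubling_with M lam C_lam"
    and "\<And>x y r. 0 < r \<Longrightarrow> dist x y \<le> r \<Longrightarrow> lam x r \<le> C_lam * lam y r"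
  shows "\<exists>C>0. \<forall>c r k x1 x2 y.
           0 < r \<longrightarrow> 2 \<le> k \<longrightarrow> x1 \<in> ball c r \<longrightarrow> x2 \<in> ball c r \<longrightarrow> y \<in> UNIV - ball c (k * r) \<longrightarrow>
             inverse C * lam x2 (dist x2 y) \<le> lam x1 (dist x1 y) \<and>
             lam x1 (dist x1 y) \<le> C * lam x2 (dist x2 y)"
proof -
  have dom: "dominating_function M lam C_lam"
    using assms(1) by (simp add: upper_doubling_with_def)
  then have C: "0 < C_lam ^ 3"
    by (simp add: dominating_function_def)
  have one_sided: "lam x1 (dist x1 y) \<le> C_lam ^ 3 * lam x2 (dist x2 y)"
    if "0 < r" "2 \<le> k" "x1 \<in> ball c r" "x2 \<in> ball c r" "y \<in> UNIV - ball c (k * r)"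
    for c r k x1 x2 y
  proof (rule lam_dist_le_of_close_centres[OF dom assms(2)])
    have far: "r < dist x1 y" "r < dist x2 y"
      using outside_doubled_ball_imp_dist_gt that by blast+
    then show "0 < dist x1 y" using that(1) by linarith
    show "dist x1 x2 \<le> 2 * dist x2 y"
      using far(2) that(3,4) dist_triangle3[of x1 x2 c] by simp
  qed
  have "inverse (C_lam ^ 3) * lam x2 (dist x2 y) \<le> lam x1 (dist x1 y)"
    if "0 < r" "2 \<le> k" "x1 \<in> ball c r" "x2 \<in> ball c r" "y \<in> UNIV - ball c (k * r)"
    for c r k x1 x2 y
    using one_sided[OF that(1,2,4,3,5)] C by (simp add: field_simps)
  with one_sided C show ?thesis by blast
qed

end
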